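(* For every graph $G$, the modified Albertson index $A^*(G)$ is a non-negative even integer.
   Context: All graphs are simple and finite (not necessarily connected). For a graph $G$ with edge set $E(G)$, $d_u$ denotes the degree of the vertex $u$ in $G$. The modified Albertson index of $G$ is $A^*(G)=\sum_{uv\in E(G)} |(d_u)^2-(d_v)^2|$. *)

theory Defs
  imports "Graph_Theory.Digraph"
begin

text \<open>
  A simple finite graph is the AFP's \<^locale>\<open>graph\<close>: a finite, loop-free, symmetric digraph
  without multiple arcs. Each undirected edge \<open>uv\<close> is thus represented by the two arcs
  \<open>(u, v)\<close> and \<open>(v, u)\<close>, and \<open>E(G)\<close> is recovered as the set of unordered pairs, so that
  each edge is counted once.
\<close>

definition edges :: "('a, 'b) pre_digraph \<Rightarrow> 'a set set" where
  "edges G = (\<lambda>a. {tail G a, head G a}) ` arcs G"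

text \<open>
  The summand does not depend on which end of the edge is called \<open>u\<close>, so the description below
  determines a unique value; see \<open>Albertson_weight_edge\<close>. By \<open>out_degree_eq_card_edges\<close>, the out-degree is the degree \<open>d\<^sub>u\<close> in the undirected sense.
\<close>

definition Albertson_weight :: "('a, 'b) pre_digraph \<Rightarrow> 'a set \<Rightarrow> int" where
  "Albertson_weight G e =
    (THE x. \<exists>u v. e = {u, v} \<and> x = \<bar>(int (out_degree G u))\<^sup>2 - (int (out_degree G v))\<^sup>2\<bar>)"

definition modified_Albertson_index :: "('a, 'b) pre_digraph \<Rightarrow> int" where
  "modified_Albertson_index G = (\<Sum>e\<in>edges G. Albertson_weight G e)"

lemma Albertson_weight_edge:
  "Albertson_weight G {u, v} = \<bar>(int (out_degree G u))\<^sup>2 - (int (out_degree G v))\<^sup>2\<bar>"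
  unfolding Albertson_weight_def
  by (rule the_equality) (auto simp: doubleton_eq_iff abs_minus_commute)

lemma (in graph) out_degree_eq_card_edges: "out_degree G u = card {e \<in> edges G. u \<in> e}"
proof -
  have sym_arc: "\<exists>b\<in>arcs G. tail G b = head G a \<and> head G b = tail G a" if "a \<in> arcs G" for a
    using that sym_arcs unfolding symmetric_def sym_def arcs_ends_conv by (force simp: image_iff)
  have "inj_on (\<lambda>a. {tail G a, head G a}) (out_arcs G u)"
    using no_multi_arcs
    by (auto simp: inj_on_def out_arcs_def arc_to_ends_def doubleton_eq_iff)
  moreover have "(\<lambda>a. {tail G a, head G a}) ` out_arcs G u = {e \<in> edges G. u \<in> e}"
  proof (intro equalityI subsetI)
    fix e assume "e \<in> {e \<in> edges G. u \<in> e}"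
    then obtain a where a: "a \<in> arcs G" "e = {tail G a, head G a}" "u = tail G a \<or> u = head G a"
      by (auto simp: edges_def)
    obtain b where "b \<in> arcs G" "tail G b = head G a" "head G b = tail G a"
      using sym_arc[OF a(1)] by blast
    with a show "e \<in> (\<lambda>a. {tail G a, head G a}) ` out_arcs G u"
      by (auto simp: out_arcs_def image_iff insert_commute)
  qed (auto simp: edges_def out_arcs_def)
  ultimately show ?thesis
    unfolding out_degree_def by (metis card_image)
qed

end

theory Submission
  imports Defs
begin

text \<open>
  Modulo 2, squares, signs and absolute values are invisible, so an edge \<open>uv\<close> contributes
  \<open>d\<^sub>u + d\<^sub>v\<close> to the index, or just as well \<open>(d\<^sub>u + 1) + (d\<^sub>v + 1)\<close>. With the second form, a vertex
  \<open>w\<close> collects \<open>d\<^sub>w + 1\<close> from each of the \<open>d\<^sub>w\<close> edges through it (\<open>sum_edges_sum_ends\<close>), that is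
  \<open>d\<^sub>w (d\<^sub>w + 1)\<close> in all, which is even at every single vertex.
\<close>

lemma (in graph) edges_cases:
  assumes "e \<in> edges G"
  obtains u v where "e = {u, v}" "u \<noteq> v" "u \<in> verts G" "v \<in> verts G"
  using assms wellformed no_loops unfolding edges_def by blast

text \<open>
  Double counting of incidences \<open>w \<in> e\<close>; the handshake lemma is the case \<open>f = (\<lambda>_. 1)\<close>.
\<close>

lemma (in graph) sum_edges_sum_ends:
  fixes f :: "'a \<Rightarrow> 'c::comm_semiring_1"
  shows "(\<Sum>e\<in>edges G. \<Sum>w\<in>e. f w) = (\<Sum>w\<in>verts G. of_nat (out_degree G w) * f w)"
proof -
  have fin: "finite (edges G)"
    by (simp add: edges_def)
  have "(\<Sum>e\<in>edges G. \<Sum>w\<in>e. f w) = (\<Sum>e\<in>edges G. \<Sum>w | w \<in> verts G \<and> w \<in> e. f w)"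
    by (intro sum.cong refl) (auto elim!: edges_cases)
  also have "\<dots> = (\<Sum>w\<in>verts G. \<Sum>e | e \<in> edges G \<and> w \<in> e. f w)"
    using fin by (intro sum.swap_restrict) simp_all
  finally show ?thesis
    by (simp add: out_degree_eq_card_edges)
qed

lemma (in graph) even_Albertson_weight_iff:
  assumes "e \<in> edges G"
  shows "even (Albertson_weight G e) \<longleftrightarrow> even (\<Sum>w\<in>e. int (out_degree G w) + 1)"
  using assms by (auto elim!: edges_cases simp: Albertson_weight_edge)

lemma (in graph) Albertson_weight_nonneg: "e \<in> edges G \<Longrightarrow> 0 \<le> Albertson_weight G e"
  by (auto elim!: edges_cases simp: Albertson_weight_edge)

theorem proposition2p4:
  fixes G :: "('a, 'b) pre_digraph"
  assumes "graph G"
  shows "0 \<le> modified_Albertson_index G \<and> even (modified_Albertson_index G)"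
proof -
  interpret graph G by fact
  have "even (\<Sum>e\<in>edges G. Albertson_weight G e - (\<Sum>w\<in>e. int (out_degree G w) + 1))"
    by (intro dvd_sum) (simp add: even_Albertson_weight_iff)
  moreover have "even (\<Sum>e\<in>edges G. \<Sum>w\<in>e. int (out_degree G w) + 1)"
    unfolding sum_edges_sum_ends by (intro dvd_sum) simp
  ultimately have "even (modified_Albertson_index G)"
    by (simp add: modified_Albertson_index_def sum_subtractf)
  then show ?thesis
    by (simp add: modified_Albertson_index_def sum_nonneg Albertson_weight_nonneg)
qed

end
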